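(* Let $M=(\mathcal{A},\mathrm{rk})$ be a matroid and let $k\ge 1$. Then $$\chi^k_M(t_1,\dots,t_k)=(-1)^{k\,\mathrm{rk}(M)}\,W^k_M(-t_1,\dots,-t_k;\,-1,\dots,-1)=(-1)^{k\,\mathrm{rk}(M)}\,T^k_M(1-t_1,\dots,1-t_k;\,0,\dots,0).$$
   Context: A matroid $M=(\mathcal{A},\mathrm{rk})$ is given by a finite ground set $\mathcal{A}$ and its rank function $\mathrm{rk}:2^{\mathcal{A}}\to\mathbb{N}$; $\mathrm{rk}(M)=\mathrm{rk}(\mathcal{A})$. For $k\ge 1$ let $\mathcal{C}^k_{\mathcal{A}}=\{(A_1,\dots,A_k)\in(2^{\mathcal{A}})^k \mid A_1\subseteq A_2\subseteq\cdots\subseteq A_k\subseteq\mathcal{A}\}$ (inclusions need not be strict). The $k$th chain characteristic polynomial is $\chi_M^k(t_1,\dots,t_k)=\sum_{(A_i)\in\mathcal{C}^k_{\mathcal{A}}}\prod_{i=1}^k(-1)^{|A_i|}t_i^{\mathrm{rk}(M)-\mathrm{rk}(A_i)}$. The $k$th chain Whitney rank generating polynomial is $W^k_M(a_1,\dots,a_k;b_1,\dots,b_k)=\sum_{(S_i)\in\mathcal{C}^k_{\mathcal{A}}}\prod_{i=1}^k a_i^{\mathrm{rk}(M)-\mathrm{rk}(S_i)}b_i^{|S_i|-\mathrm{rk}(S_i)}$. The $k$th chain Tutte polynomial is $T^k_M(x_1,\dots,x_k;y_1,\dots,y_k)=W^k_M(x_1-1,\dots,x_k-1;y_1-1,\dots,y_k-1)$.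 *)

theory Defs
  imports Complex_Main "HOL-Library.FuncSet"
begin

text \<open>Matroids given by a finite ground set and a rank function, with the standard rank axioms.
  As \<open>rk\<close> is a total function on \<open>'e set\<close>, the axioms only concern subsets of \<open>E\<close>; its values
  on other sets are arbitrary and never used below.\<close>

locale matroid =
  fixes E :: "'e set" and rk :: "'e set \<Rightarrow> nat"
  assumes finite_ground: "finite E"
    and rk_le_card: "X \<subseteq> E \<Longrightarrow> rk X \<le> card X"
    and rk_mono: "X \<subseteq> Y \<Longrightarrow> Y \<subseteq> E \<Longrightarrow> rk X \<le> rk Y"
    and rk_submodular:
      "X \<subseteq> E \<Longrightarrow> Y \<subseteq> E \<Longrightarrow> rk (X \<union> Y) + rk (X \<inter> Y) \<le> rk X + rk Y"

text \<open>A \<open>k\<close>-tuple is encoded as an extensional function on \<open>{1..k}\<close>, so that distinct elements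
  of \<open>chains E k\<close> are distinct tuples.\<close>

definition chains :: "'e set \<Rightarrow> nat \<Rightarrow> (nat \<Rightarrow> 'e set) set" where
  "chains E k = {S \<in> {1..k} \<rightarrow>\<^sub>E Pow E. \<forall>i\<in>{1..<k}. S i \<subseteq> S (Suc i)}"

lemma finite_chains: "finite E \<Longrightarrow> finite (chains E k)"
  unfolding chains_def
  by (rule finite_subset[where B = "{1..k} \<rightarrow>\<^sub>E Pow E"]) (auto intro: finite_PiE)

text \<open>The integer polynomials below are given by their values at elements of an arbitrary
  commutative ring. Taking that ring to be a polynomial ring and the arguments to be its
  indeterminates yields the formal polynomials. Of the arguments \<open>t\<close>, \<open>a\<close>, \<open>b\<close>, \<open>x\<close>, \<open>y\<close> only the
  values at \<open>1, \<dots>, k\<close> matter. For a matroid the natural number subtractions in the exponents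
  never truncate, by \<open>rk_mono\<close> and \<open>rk_le_card\<close>.\<close>

definition chain_char_poly ::
    "'e set \<Rightarrow> ('e set \<Rightarrow> nat) \<Rightarrow> nat \<Rightarrow> (nat \<Rightarrow> 'a::comm_ring_1) \<Rightarrow> 'a" where
  "chain_char_poly E rk k t =
     (\<Sum>A\<in>chains E k. \<Prod>i=1..k. (-1) ^ card (A i) * t i ^ (rk E - rk (A i)))"

definition chain_whitney_poly ::
    "'e set \<Rightarrow> ('e set \<Rightarrow> nat) \<Rightarrow> nat \<Rightarrow> (nat \<Rightarrow> 'a::comm_ring_1) \<Rightarrow> (nat \<Rightarrow> 'a) \<Rightarrow> 'a" where
  "chain_whitney_poly E rk k a b =
     (\<Sum>S\<in>chains E k. \<Prod>i=1..k. a i ^ (rk E - rk (S i)) * b i ^ (card (S i) - rk (S i)))"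

definition chain_tutte_poly ::
    "'e set \<Rightarrow> ('e set \<Rightarrow> nat) \<Rightarrow> nat \<Rightarrow> (nat \<Rightarrow> 'a::comm_ring_1) \<Rightarrow> (nat \<Rightarrow> 'a) \<Rightarrow> 'a" where
  "chain_tutte_poly E rk k x y =
     chain_whitney_poly E rk k (\<lambda>i. x i - 1) (\<lambda>i. y i - 1)"

end

theory Submission
  imports Defs
begin

text \<open>The identity already holds factor by factor. For a set of rank \<open>s\<close> and size
  \<open>c\<close> in a matroid of rank \<open>r\<close>, the Whitney factor at \<open>- t\<close>
  and \<open>- 1\<close> carries the sign exponent \<open>(r - s) + (c - s)\<close>, which has the
  parity of \<open>r + c\<close>; multiplying by \<open>(-1) ^ r\<close> leaves
  \<open>(-1) ^ c\<close>, the sign in the characteristic polynomial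
  (\<open>signed_whitney_factor\<close>). The \<open>k\<close> factors of a chain together absorb
  \<open>(-1) ^ (k * r)\<close>, the same for every chain, so it leaves the sum.\<close>

lemma signed_whitney_factor:
  fixes t :: "'a::comm_ring_1" and r s c :: nat
  assumes "s \<le> r" "s \<le> c"
  shows "(-1) ^ r * ((- t) ^ (r - s) * (-1) ^ (c - s)) = (-1) ^ c * t ^ (r - s)"
proof -
  \<comment> \<open>The assumptions keep both subtractions from truncating; the surplus over
    \<open>c\<close> is even.\<close>
  have exponent: "r + (r - s) + (c - s) = c + 2 * (r - s)"
    using assms by simp
  have "(-1) ^ r * ((- t) ^ (r - s) * (-1) ^ (c - s))
      = (-1) ^ (r + (r - s) + (c - s)) * t ^ (r - s)"
    by (simp only: power_minus[of t] power_add ac_simps)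
  also have "\<dots> = (-1) ^ c * t ^ (r - s)"
    unfolding exponent by (simp add: power_add power_mult)
  finally show ?thesis .
qed

lemma (in matroid) chain_char_poly_eq_whitney:
  fixes t :: "nat \<Rightarrow> 'b::comm_ring_1"
  shows "chain_char_poly E rk k t
    = (-1) ^ (k * rk E) * chain_whitney_poly E rk k (\<lambda>i. - t i) (\<lambda>i. - 1)"
proof -
  have "(\<Prod>i=1..k. (-1) ^ card (S i) * t i ^ (rk E - rk (S i)))
      = (-1) ^ (k * rk E)
        * (\<Prod>i=1..k. (- t i) ^ (rk E - rk (S i)) * (-1) ^ (card (S i) - rk (S i)))"
    if S: "S \<in> chains E k" for S
  proof -
    have sub: "S i \<subseteq> E" if "i \<in> {1..k}" for i
      using S that by (auto simp: chains_def PiE_iff)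
    have "(\<Prod>i=1..k. (-1) ^ card (S i) * t i ^ (rk E - rk (S i)))
        = (\<Prod>i=1..k. (-1) ^ rk E
            * ((- t i) ^ (rk E - rk (S i)) * (-1) ^ (card (S i) - rk (S i))))"
      \<comment> \<open>The matroid axioms enter here: \<open>rk_mono\<close> gives
        \<open>s \<le> r\<close> and \<open>rk_le_card\<close> gives
        \<open>s \<le> c\<close>.\<close>
      by (intro prod.cong refl signed_whitney_factor[symmetric] rk_mono rk_le_card sub order_refl)
    then show ?thesis
      \<comment> \<open>Commuting the exponent to \<open>rk E * k\<close> exhibits the global sign
        as the \<open>k\<close>-fold product of \<open>(-1) ^ rk E\<close>.\<close>
      by (simp add: prod.distrib mult.commute[of k] power_mult)
  qed
  then show ?thesis
    unfolding chain_char_poly_def chain_whitney_poly_def sum_distrib_left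
    by (intro sum.cong refl)
qed

theorem theorem1p4:
  fixes E :: "'e set" and rk :: "'e set \<Rightarrow> nat" and k :: nat
    and t :: "nat \<Rightarrow> 'a::comm_ring_1"
  assumes "matroid E rk" and "k \<ge> 1"
  shows "chain_char_poly E rk k t
           = (-1) ^ (k * rk E) * chain_whitney_poly E rk k (\<lambda>i. - t i) (\<lambda>i. - 1)
       \<and> (-1) ^ (k * rk E) * chain_whitney_poly E rk k (\<lambda>i. - t i) (\<lambda>i. - 1)
           = (-1) ^ (k * rk E) * chain_tutte_poly E rk k (\<lambda>i. 1 - t i) (\<lambda>i. 0)"
  \<comment> \<open>The Tutte form is the substitution \<open>(1 - t i) - 1 = - t i\<close> and
    \<open>0 - 1 = - 1\<close>.\<close>
  using matroid.chain_char_poly_eq_whitney[OF assms(1)]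
  by (simp add: chain_tutte_poly_def)

end
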